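(* Let $m,s\ge1$ be integers, let $C_1,\dots,C_s\in\{0,1\}^{m\times m}$, and let $\boldsymbol{x}_0,\dots,\boldsymbol{x}_{2^m-1}\in[0,1)^s$ be the digital net in base $2$ generated by $C_1,\dots,C_s$, with maximal gain coefficient $\Gamma=\max_{\emptyset\ne u\subseteq\{1,\dots,s\}}\max_{\boldsymbol{k}\in\mathbb{N}_0^{|u|}}\Gamma_{u,\boldsymbol{k}}$. If there exists a nonempty $u\subseteq\{1,\dots,s\}$ with $\mathrm{rank}(C_{u,\mathbf{1}_u})<|u|$, then $\Gamma=2^m$. Otherwise, $\Gamma=2^{t^*_{\{1,\dots,s\}}+s-1}$.
   Context: All matrix and vector arithmetic on bits, and all ranks, are over the field $\mathbb{Z}_2$. $\mathbb{N}_0$ is the set of non-negative integers. Digital net: for an integer $0\le i<2^m$ with $i=\sum_{\ell=1}^m i_\ell2^{\ell-1}$, $i_\ell\in\{0,1\}$, let $\vec{i}=(i_1,\dots,i_m)^{\mathsf T}$. The digital net generated by $C_1,\dots,C_s$ is $\boldsymbol{x}_i=(x_{i1},\dots,x_{is})$ with $x_{ij}=\sum_{\ell=1}^m x_{ij\ell}2^{-\ell}$, where $(x_{ij1},\dots,x_{ijm})^{\mathsf T}=C_j\vec{i}$ mod $2$. Matrices: $C_j(\ell,:)$ denotes row $\ell$ of $C_j$, with the convention that $C_j(\ell,:)$ is the zero row of length $m$ for $\ell>m$. For nonempty $u\subseteq\{1,\dots,s\}$ and $\boldsymbol{k}=(k_j)_{j\in u}\in\mathbb{N}_0^{|u|}$,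 $C_{u,\boldsymbol{k}}$ is the matrix with $|\boldsymbol{k}|=\sum_{j\in u}k_j$ rows and $m$ columns obtained by stacking the rows $C_j(\ell,:)$, $1\le\ell\le k_j$, for $j\in u$. "Full rank" means full row rank, i.e. $\mathrm{rank}(C_{u,\boldsymbol{k}})=|\boldsymbol{k}|$. $\mathbf{1}_u=(1,\dots,1)\in\mathbb{N}_0^{|u|}$. The parameter $t_u^*$: for nonempty $u\subseteq\{1,\dots,s\}$, $$t_u^*=m+1-\min\bigl\{|\boldsymbol{k}| : \boldsymbol{k}\in\mathbb{N}_0^{|u|},\ \boldsymbol{k}\ge\mathbf{1}_u\text{ componentwise},\ C_{u,\boldsymbol{k}}\text{ not of full rank}\bigr\}.$$ Gain coefficients: let $n=2^m$. For $x,x'\in[0,1)$ let $M(x,x')=\max\{k\in\mathbb{N}_0: \lfloor 2^kx\rfloor=\lfloor 2^kx'\rfloor\}\in\mathbb{N}_0\cup\{\infty\}$ (equal to $\infty$ when $x=x'$). For nonempty $u\subseteq\{1,\dots,s\}$, $\boldsymbol{k}=(k_j)_{j\in u}\in\mathbb{N}_0^{|u|}$, $j\in u$ and $0\le i,i'<n$, put $N_{i,i',j}=0$ if $M(x_{ij},x_{i'j})<k_j$, $-1$ if $M(x_{ij},x_{i'j})=k_j$, and $1$ if $M(x_{ij},x_{i'j})>k_j$. Then $\Gamma_{u,\boldsymbol{k}}=\frac1n\sum_{i=0}^{n-1}\sum_{i'=0}^{n-1}\prod_{j\in u}N_{i,i',j}$. *)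

theory Defs
  imports
    Complex_Main
    "HOL-Library.Z2"
    "HOL-Library.Extended_Nat"
    "Jordan_Normal_Form.DL_Rank"
begin

(* Coordinates and matrix rows are numbered from 1, as in the mathematics; entries of vectors and
   matrices are numbered from 0, as in the library. A tuple k indexed by u is a total function
   nat => nat of which only the values on u are used. *)

definition digit_vec :: "nat \<Rightarrow> nat \<Rightarrow> bit vec" where
  "digit_vec m i = vec m (\<lambda>l. of_bool (odd (i div 2 ^ l)))"

definition digital_net :: "nat \<Rightarrow> (nat \<Rightarrow> bit mat) \<Rightarrow> nat \<Rightarrow> nat \<Rightarrow> real" where
  "digital_net m C i j =
     (\<Sum>l = 1..m. of_bool ((C j *\<^sub>v digit_vec m i) $ (l - 1) = 1) / 2 ^ l)"

definition gen_row :: "nat \<Rightarrow> bit mat \<Rightarrow> nat \<Rightarrow> bit vec" where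
  "gen_row m A l = (if l \<le> m then row A (l - 1) else 0\<^sub>v m)"

definition stacked :: "nat \<Rightarrow> (nat \<Rightarrow> bit mat) \<Rightarrow> nat set \<Rightarrow> (nat \<Rightarrow> nat) \<Rightarrow> bit mat" where
  "stacked m C u k = mat_of_rows m
     (concat (map (\<lambda>j. map (gen_row m (C j)) [1..<Suc (k j)]) (sorted_list_of_set u)))"

(* The first argument of vec_space.rank is the number of rows. *)
abbreviation mat_rank :: "bit mat \<Rightarrow> nat" where
  "mat_rank A \<equiv> vec_space.rank (dim_row A) A"

definition full_row_rank :: "bit mat \<Rightarrow> bool" where
  "full_row_rank A \<longleftrightarrow> mat_rank A = dim_row A"

(* For finite nonempty u the minimum is over a nonempty set, as rows beyond the m-th vanish. It may
   exceed m + 1 when u has more than m + 1 elements, so the parameter is an integer. *)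
definition t_star :: "nat \<Rightarrow> (nat \<Rightarrow> bit mat) \<Rightarrow> nat set \<Rightarrow> int" where
  "t_star m C u = int m + 1 -
     int (LEAST w. \<exists>k. w = (\<Sum>j\<in>u. k j) \<and> (\<forall>j\<in>u. 1 \<le> k j) \<and> \<not> full_row_rank (stacked m C u k))"

(* For distinct x and x' in [0,1) the set is finite and contains 0. *)
definition common_digits :: "real \<Rightarrow> real \<Rightarrow> enat" where
  "common_digits x x' =
     (if x = x' then \<infinity> else enat (Max {k. \<lfloor>2 ^ k * x\<rfloor> = \<lfloor>2 ^ k * x'\<rfloor>}))"

definition gain_factor :: "nat \<Rightarrow> real \<Rightarrow> real \<Rightarrow> real" where
  "gain_factor k x x' =
     (if common_digits x x' < enat k then 0 else if common_digits x x' = enat k then - 1 else 1)"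

definition gain :: "nat \<Rightarrow> (nat \<Rightarrow> bit mat) \<Rightarrow> nat set \<Rightarrow> (nat \<Rightarrow> nat) \<Rightarrow> real" where
  "gain m C u k = (1 / 2 ^ m) * (\<Sum>i<2 ^ m. \<Sum>i'<2 ^ m.
     \<Prod>j\<in>u. gain_factor (k j) (digital_net m C i j) (digital_net m C i' j))"

(* The inner maximum ranges over finitely many values although k is unbounded: distinct net
   coordinates differ within their first m digits, so replacing k j by min (k j) m changes
   nothing. *)
definition max_gain :: "nat \<Rightarrow> nat \<Rightarrow> (nat \<Rightarrow> bit mat) \<Rightarrow> real" where
  "max_gain m s C =
     Max ((\<lambda>u. Max (range (gain m C u))) ` {u. u \<noteq> {} \<and> u \<subseteq> {1..s}})"

end

theory Submission
  imports Defs
begin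

text \<open>Writing the gain factors through the characters of the additive group of bit vectors and
  expanding the product turns the gain coefficient at (u, k) into 2^(m - |k|) times the number of
  subsets of the first k(j) rows of the matrices that, together with all rows number k(j) + 1, sum
  to zero. With a set J of independent rows among the first k(j), such a subset is determined by its
  part outside J, so the gain is at most 2^(m - |J|).

  Let w be the least weight of a tuple of positive numbers whose stacked matrix is rank deficient.
  A nonzero gain at (u, k) makes the rows up to k(j) + 1 on u and up to 1 elsewhere dependent, so
  |k| is at least w - s; by minimality of w, any smaller tuple of weight w - s on u gives independent
  rows, and the gain is at most 2^(m - w + s). Conversely, the last rows of the blocks that occur in
  a relation for the minimising tuple yield a gain of at least that size. If first rows alone are
  already dependent, then w = s.\<close>

section \<open>Characters of bit vectors and their orthogonality\<close>

definition chi :: "bit \<Rightarrow> real" where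
  "chi b = (if b = 1 then - 1 else 1)"

definition digit :: "nat \<Rightarrow> nat \<Rightarrow> bit" where
  "digit i p = of_bool (odd (i div 2 ^ p))"

text \<open>As \<open>i\<close> runs through the numbers below \<open>2 ^ m\<close>, its digits run
  through all bit vectors of length \<open>m\<close>; sums over such \<open>i\<close> are thus sums
  over the whole vector space.\<close>

definition dot :: "nat \<Rightarrow> (nat \<Rightarrow> bit) \<Rightarrow> nat \<Rightarrow> bit" where
  "dot m a i = (\<Sum>p<m. a p * digit i p)"

text \<open>A set of vectors over the two-element field is dependent here when it sums to zero as a whole, so
  that linear dependence means containing a nonempty dependent subset. The index type keeps repeated
  vectors apart.\<close>

definition dependent :: "nat \<Rightarrow> ('e \<Rightarrow> nat \<Rightarrow> bit) \<Rightarrow> 'e set \<Rightarrow> bool" where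
  "dependent m r T \<longleftrightarrow> (\<forall>p<m. (\<Sum>e\<in>T. r e p) = 0)"

definition independent :: "nat \<Rightarrow> ('e \<Rightarrow> nat \<Rightarrow> bit) \<Rightarrow> 'e set \<Rightarrow> bool" where
  "independent m r I \<longleftrightarrow> (\<forall>T\<subseteq>I. dependent m r T \<longrightarrow> T = {})"

lemma chi_0 [simp]: "chi 0 = 1"
  by (simp add: chi_def)

lemma chi_add: "chi (a + b) = chi a * chi b"
  by (cases a; cases b) (simp_all add: chi_def)

lemma chi_sum: "finite A \<Longrightarrow> chi (\<Sum>e\<in>A. f e) = (\<Prod>e\<in>A. chi (f e))"
  by (induction A rule: finite_induct) (simp_all add: chi_add del: add_bit_eq_xor)

lemma dot_Suc_low:
  assumes "i < 2 ^ m"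
  shows "dot (Suc m) a i = dot m a i"
  using assms by (simp add: dot_def digit_def)

lemma dot_Suc_high:
  assumes "i < 2 ^ m"
  shows "dot (Suc m) a (i + 2 ^ m) = dot m a i + a m"
proof -
  have "digit (i + 2 ^ m) p = digit i p" if "p < m" for p
  proof -
    \<comment> \<open>Since \<open>p < m\<close>, the number \<open>2 ^ m\<close> is an even
      multiple of \<open>2 ^ p\<close>, so adding it leaves digit \<open>p\<close>
      unchanged.\<close>
    have "(2::nat) ^ m = 2 ^ (m - p) * 2 ^ p"
      using that by (simp flip: power_add)
    then show ?thesis
      using that by (simp add: digit_def)
  qed
  moreover have "digit (i + 2 ^ m) m = 1"
    using assms by (simp add: digit_def)
  ultimately show ?thesis
    by (simp add: dot_def)
qed

text \<open>Orthogonality of characters. Splitting off the top digit yields the factor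
  \<open>1 + chi (a m)\<close>, which is 2 if \<open>a m = 0\<close> and 0 otherwise.\<close>

lemma sum_chi_dot:
  "(\<Sum>i<2 ^ m. chi (dot m a i)) = (if \<forall>p<m. a p = 0 then 2 ^ m else 0)"
proof (induction m)
  case 0
  then show ?case by (simp add: dot_def)
next
  case (Suc m)
  have "(\<Sum>i<2 ^ Suc m. chi (dot (Suc m) a i)) =
      (\<Sum>i<2 ^ m. chi (dot (Suc m) a i)) + (\<Sum>i<2 ^ m. chi (dot (Suc m) a (i + 2 ^ m)))"
    using sum.atLeastLessThan_concat[of 0 "2 ^ m" "2 ^ m + 2 ^ m" "\<lambda>i. chi (dot (Suc m) a i)"]
      sum.shift_bounds_nat_ivl[of "\<lambda>i. chi (dot (Suc m) a i)" 0 "2 ^ m" "2 ^ m"]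
    by (simp add: atLeast0LessThan mult_2)
  also have "\<dots> = (1 + chi (a m)) * (\<Sum>i<2 ^ m. chi (dot m a i))"
    by (simp add: dot_Suc_low dot_Suc_high chi_add distrib_right mult.commute
        del: add_bit_eq_xor flip: sum_distrib_left)
  finally show ?case
    using Suc.IH by (cases "a m") (auto simp: chi_def less_Suc_eq)
qed

lemma sum_dot: "(\<Sum>e\<in>T. dot m (r e) i) = dot m (\<lambda>p. \<Sum>e\<in>T. r e p) i"
  unfolding dot_def sum_distrib_right by (rule sum.swap)

lemma prod_one_plus:
  fixes f :: "'e \<Rightarrow> real"
  assumes "finite I"
  shows "(\<Prod>e\<in>I. 1 + f e) = (\<Sum>T\<in>Pow I. \<Prod>e\<in>T. f e)"
  using prod_add[OF assms, of f "\<lambda>_. 1"] by (simp add: add.commute)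

section \<open>Dependent sets and linear systems over bits\<close>

text \<open>In characteristic two the elements common to \<open>S\<close> and \<open>T\<close>,
  counted twice when the two relations are added, cancel.\<close>

lemma dependent_sym_diff:
  assumes "finite S" "finite T" "dependent m r S" "dependent m r T"
  shows "dependent m r (S - T \<union> (T - S))"
  unfolding dependent_def
proof (intro allI impI)
  fix p assume "p < m"
  then have 0: "(\<Sum>e\<in>S. r e p) = 0" "(\<Sum>e\<in>T. r e p) = 0"
    using assms(3,4) by (auto simp: dependent_def)
  have "(\<Sum>e\<in>S. r e p) = (\<Sum>e\<in>S - T. r e p) + (\<Sum>e\<in>S \<inter> T. r e p)"
    using assms(1) by (subst sum.union_disjoint[symmetric]) (auto intro: sum.cong)
  moreover have "(\<Sum>e\<in>T. r e p) = (\<Sum>e\<in>T - S. r e p) + (\<Sum>e\<in>S \<inter> T. r e p)"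
    using assms(2) by (subst sum.union_disjoint[symmetric]) (auto intro: sum.cong)
  ultimately have "(\<Sum>e\<in>S - T. r e p) + (\<Sum>e\<in>T - S. r e p) = 0"
    using 0 by (cases "\<Sum>e\<in>S - T. r e p"; cases "\<Sum>e\<in>T - S. r e p";
      cases "\<Sum>e\<in>S \<inter> T. r e p") simp_all
  then show "(\<Sum>e\<in>S - T \<union> (T - S). r e p) = 0"
    using assms(1,2) by (subst sum.union_disjoint) auto
qed

lemma independent_subset: "independent m r I \<Longrightarrow> J \<subseteq> I \<Longrightarrow> independent m r J"
  unfolding independent_def by blast

text \<open>The product of the terms \<open>1 + chi (b e) * chi (dot m (r e) i)\<close> is nonzero
  exactly when \<open>i\<close> solves the system. Summed over \<open>i\<close>, its expansion keeps
  only the empty subset, by orthogonality and independence, so the total is \<open>2 ^ m\<close> and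
  some \<open>i\<close> is a solution.\<close>

lemma solvable_if_independent:
  assumes "finite I" and "independent m r I"
  obtains i where "i < 2 ^ m" and "\<And>e. e \<in> I \<Longrightarrow> dot m (r e) i = b e"
proof -
  have "(\<Sum>i<2 ^ m. \<Prod>e\<in>I. 1 + chi (b e) * chi (dot m (r e) i)) =
      (\<Sum>i<2 ^ m. \<Sum>T\<in>Pow I. \<Prod>e\<in>T. chi (b e) * chi (dot m (r e) i))"
    using assms(1) by (simp add: prod_one_plus)
  also have "\<dots> = (\<Sum>T\<in>Pow I. (\<Prod>e\<in>T. chi (b e)) * (\<Sum>i<2 ^ m. \<Prod>e\<in>T. chi (dot m (r e) i)))"
    by (subst sum.swap) (simp add: sum_distrib_left prod.distrib)
  also have "\<dots> = (\<Sum>T\<in>Pow I. if T = {} then 2 ^ m else 0)"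
  proof (rule sum.cong)
    fix T assume T: "T \<in> Pow I"
    then have "finite T" using assms(1) finite_subset by auto
    then have "(\<Sum>i<2 ^ m. \<Prod>e\<in>T. chi (dot m (r e) i)) = (if dependent m r T then 2 ^ m else 0)"
      by (simp add: sum_dot sum_chi_dot dependent_def flip: chi_sum)
    moreover have "dependent m r T \<longleftrightarrow> T = {}"
      using assms(2) T by (auto simp: dependent_def independent_def)
    ultimately show "(\<Prod>e\<in>T. chi (b e)) * (\<Sum>i<2 ^ m. \<Prod>e\<in>T. chi (dot m (r e) i)) =
        (if T = {} then 2 ^ m else 0)"
      by simp
  qed simp
  also have "\<dots> \<noteq> 0"
    using assms(1) by simp
  finally obtain i where i: "i < 2 ^ m" "(\<Prod>e\<in>I. 1 + chi (b e) * chi (dot m (r e) i)) \<noteq> 0"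
    by (meson lessThan_iff sum.not_neutral_contains_not_neutral)
  have "dot m (r e) i = b e" if "e \<in> I" for e
  proof -
    have "1 + chi (b e) * chi (dot m (r e) i) \<noteq> 0"
      using i(2) that assms(1) by auto
    then show ?thesis
      by (cases "b e"; cases "dot m (r e) i") (auto simp: chi_def)
  qed
  with i(1) show ?thesis by (rule that)
qed

section \<open>Full row rank as surjectivity\<close>

text \<open>Both sides say that the columns span the whole space. In the form of solvability, full
  row rank can be compared with \<open>independent\<close>.\<close>

lemma rank_eq_dim_row_iff:
  fixes M :: "'a :: field mat"
  assumes "M \<in> carrier_mat q c"
  shows "vec_space.rank q M = q \<longleftrightarrow> (\<forall>b\<in>carrier_vec q. \<exists>x\<in>carrier_vec c. M *\<^sub>v x = b)"
proof -
  interpret vec_space "TYPE('a)" q .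
  have cols: "set (cols M) \<subseteq> carrier_vec q"
    using assms cols_dim by blast
  have "(\<forall>b\<in>carrier_vec q. \<exists>x\<in>carrier_vec c. M *\<^sub>v x = b) \<longleftrightarrow> span (set (cols M)) = carrier_vec q"
  proof -
    have "span (set (cols M)) = {b \<in> carrier_vec q. \<exists>x\<in>carrier_vec c. M *\<^sub>v x = b}"
      using col_space_eq[OF assms] assms unfolding col_space_def by simp
    then show ?thesis by blast
  qed
  moreover have "rank M = q" if "span (set (cols M)) = carrier_vec q"
  proof -
    have "span_vs (set (cols M)) = V"
      unfolding that by (simp add: module_vec_def)
    then show ?thesis
      unfolding rank_def using dim_is_n by simp
  qed
  moreover have "span (set (cols M)) = carrier_vec q" if "rank M = q"
  proof -
    \<comment> \<open>The rank is the size of a maximal independent set of columns, and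
      \<open>q\<close> independent vectors in dimension \<open>q\<close> form a basis.\<close>
    obtain S where S: "finite S" "maximal S (\<lambda>T. T \<subseteq> set (cols M) \<and> lin_indpt T)"
      using maximal_exists_superset[of "set (cols M)" "\<lambda>T. T \<subseteq> set (cols M) \<and> lin_indpt T" "{}"]
        finite_lin_indpt2[of "{}"] by auto
    then have SM: "S \<subseteq> set (cols M)" "lin_indpt S"
      by (auto simp: maximal_def)
    have "card S = q"
      using rank_card_indpt[OF assms S(2)] that by simp
    then have "basis S"
      using SM cols S(1) fin_dim by (intro dim_li_is_basis) (auto simp: dim_is_n)
    then have "span S = carrier_vec q"
      by (simp add: basis_def)
    then show ?thesis
      using span_is_monotone[OF SM(1)] span_closed[OF cols] by auto
  qed
  ultimately show ?thesis by blast
qed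

section \<open>Binary digits and gain factors\<close>

text \<open>The integer with binary digits \<open>b 1\<close>, ..., \<open>b k\<close>, most
  significant first.\<close>

fun leading :: "(nat \<Rightarrow> bool) \<Rightarrow> nat \<Rightarrow> int" where
  "leading b 0 = 0"
| "leading b (Suc k) = 2 * leading b k + of_bool (b (Suc k))"

definition dyadic :: "nat \<Rightarrow> (nat \<Rightarrow> bool) \<Rightarrow> real" where
  "dyadic m b = (\<Sum>l = 1..m. of_bool (b l) / 2 ^ l)"

lemma leading_eq_iff: "leading b k = leading b' k \<longleftrightarrow> (\<forall>l\<in>{1..k}. b l = b' l)"
proof (induction k)
  case (Suc k)
  have "leading b (Suc k) = leading b' (Suc k) \<longleftrightarrow>
      leading b k = leading b' k \<and> b (Suc k) = b' (Suc k)"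
    by (cases "b (Suc k)"; cases "b' (Suc k)") (simp_all, presburger+)
  then show ?case
    using Suc.IH by (auto simp: atLeastAtMostSuc_conv)
qed simp

lemma dyadic_eq_leading: "2 ^ k * dyadic k b = of_int (leading b k)"
proof (induction k)
  case (Suc k)
  have "2 ^ Suc k * dyadic (Suc k) b = 2 * (2 ^ k * dyadic k b) + of_bool (b (Suc k))"
    by (simp add: dyadic_def algebra_simps)
  then show ?case
    using Suc.IH by simp
qed (simp add: dyadic_def)

text \<open>The digits after the \<open>k\<close>-th add at most a geometric sum. Keeping the term
  \<open>1 / 2 ^ m\<close> lets the induction go through and makes the bound used for the floor
  strict.\<close>

lemma dyadic_tail:
  "k \<le> m \<Longrightarrow> dyadic k b \<le> dyadic m b \<and> dyadic m b \<le> dyadic k b + 1 / 2 ^ k - 1 / 2 ^ m"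
proof (induction m rule: dec_induct)
  case (step m)
  have "dyadic (Suc m) b = dyadic m b + of_bool (b (Suc m)) / 2 ^ Suc m"
    by (simp add: dyadic_def)
  moreover have "(1::real) / 2 ^ m = 1 / 2 ^ Suc m + 1 / 2 ^ Suc m"
    by simp
  moreover have "0 \<le> (of_bool (b (Suc m)) / 2 ^ Suc m :: real)"
    and "(of_bool (b (Suc m)) / 2 ^ Suc m :: real) \<le> 1 / 2 ^ Suc m"
    by (simp_all add: divide_right_mono)
  ultimately show ?case
    using step.IH by linarith
qed simp

text \<open>After scaling by \<open>2 ^ k\<close>, the digits beyond the \<open>k\<close>-th
  contribute less than 1. If \<open>k\<close> exceeds \<open>m\<close>, the assumption makes the
  additional digits zero.\<close>

lemma floor_dyadic:
  assumes "\<And>l. b l \<Longrightarrow> l \<le> m"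
  shows "\<lfloor>2 ^ k * dyadic m b\<rfloor> = leading b k"
proof (cases "k \<le> m")
  case True
  have "2 ^ k * dyadic k b \<le> 2 ^ k * dyadic m b"
    using dyadic_tail[OF True] by simp
  moreover have "2 ^ k * dyadic m b < 2 ^ k * (dyadic k b + 1 / 2 ^ k)"
  proof -
    have "(0::real) < 1 / 2 ^ m" by simp
    then have "dyadic m b < dyadic k b + 1 / 2 ^ k"
      using dyadic_tail[OF True, of b] by linarith
    then show ?thesis by simp
  qed
  ultimately show ?thesis
    using dyadic_eq_leading[of k b] by (simp add: floor_eq_iff distrib_left)
next
  case False
  then have "dyadic k b = dyadic m b"
    unfolding dyadic_def using assms by (intro sum.mono_neutral_right) auto
  then show ?thesis
    using dyadic_eq_leading[of k b] by simp
qed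

text \<open>Equal points have equal floors at every scale, hence equal digits. For distinct points,
  \<open>common_digits\<close> is one less than the first position at which the digits
  differ.\<close>

lemma gain_factor_dyadic:
  assumes "\<And>l. b l \<Longrightarrow> l \<le> m" and "\<And>l. b' l \<Longrightarrow> l \<le> m"
  shows "gain_factor k (dyadic m b) (dyadic m b') =
    (if \<exists>l\<in>{1..k}. b l \<noteq> b' l then 0 else if b (Suc k) \<noteq> b' (Suc k) then - 1 else 1)"
proof -
  have floors: "\<lfloor>2 ^ k * dyadic m b\<rfloor> = \<lfloor>2 ^ k * dyadic m b'\<rfloor> \<longleftrightarrow> (\<forall>l\<in>{1..k}. b l = b' l)" for k
    by (simp add: floor_dyadic assms leading_eq_iff)
  show ?thesis
  proof (cases "dyadic m b = dyadic m b'")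
    case True
    then have "b l = b' l" if "1 \<le> l" for l
      using floors[of l] that by auto
    then show ?thesis
      using True by (auto simp: gain_factor_def common_digits_def)
  next
    case False
    then have "\<exists>l. 1 \<le> l \<and> b l \<noteq> b' l"
      by (force simp: dyadic_def intro: sum.cong)
    define l0 where "l0 = (LEAST l. 1 \<le> l \<and> b l \<noteq> b' l)"
    have l0: "1 \<le> l0" "b l0 \<noteq> b' l0"
      using LeastI_ex[OF \<open>\<exists>l. 1 \<le> l \<and> b l \<noteq> b' l\<close>] by (auto simp: l0_def)
    have below: "b l = b' l" if "1 \<le> l" "l < l0" for l
      using not_less_Least[of l "\<lambda>l. 1 \<le> l \<and> b l \<noteq> b' l"] that by (auto simp: l0_def)
    have "{k. \<lfloor>2 ^ k * dyadic m b\<rfloor> = \<lfloor>2 ^ k * dyadic m b'\<rfloor>} = {..l0 - 1}"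
      unfolding floors using l0 below by (force simp: not_le)
    then have "common_digits (dyadic m b) (dyadic m b') = enat (l0 - 1)"
      using False by (simp add: common_digits_def Max_eq_iff)
    moreover have "(\<exists>l\<in>{1..k}. b l \<noteq> b' l) \<longleftrightarrow> l0 \<le> k"
    proof
      assume "\<exists>l\<in>{1..k}. b l \<noteq> b' l"
      then obtain l where l: "l \<in> {1..k}" "b l \<noteq> b' l" by blast
      then have "\<not> l < l0"
        using below[of l] by auto
      then show "l0 \<le> k"
        using l(1) by simp
    next
      assume "l0 \<le> k"
      then show "\<exists>l\<in>{1..k}. b l \<noteq> b' l"
        using l0 by (intro bexI[of _ l0]) auto
    qed
    moreover have "b (Suc k) \<noteq> b' (Suc k) \<longleftrightarrow> l0 = Suc k" if "k < l0"
    proof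
      assume "b (Suc k) \<noteq> b' (Suc k)"
      then have "\<not> Suc k < l0"
        using below[of "Suc k"] by auto
      then show "l0 = Suc k"
        using that by simp
    qed (use l0 in simp)
    ultimately show ?thesis
      using l0(1) by (auto simp: gain_factor_def)
  qed
qed

section \<open>Gain coefficients as counts of dependent sets\<close>

text \<open>A label \<open>(j, l)\<close> stands for row \<open>l\<close> of \<open>C j\<close>, so
  that equal rows at different places stay apart.\<close>

definition row_entry :: "nat \<Rightarrow> (nat \<Rightarrow> bit mat) \<Rightarrow> nat \<times> nat \<Rightarrow> nat \<Rightarrow> bit" where
  "row_entry m C e p = gen_row m (C (fst e)) (snd e) $ p"

definition row_set :: "nat set \<Rightarrow> (nat \<Rightarrow> nat) \<Rightarrow> (nat \<times> nat) set" where
  "row_set u k = (SIGMA j:u. {1..k j})"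

text \<open>The digits produced by these rows decide the signs of the nonzero gain factors.\<close>

definition next_rows :: "nat set \<Rightarrow> (nat \<Rightarrow> nat) \<Rightarrow> (nat \<times> nat) set" where
  "next_rows u k = (\<lambda>j. (j, Suc (k j))) ` u"

text \<open>The conjunct \<open>l \<le> m\<close> provides the vanishing of later digits that
  \<open>gain_factor_dyadic\<close> assumes.\<close>

lemma digital_net_eq_dyadic:
  assumes "C j \<in> carrier_mat m m"
  shows "digital_net m C i j = dyadic m (\<lambda>l. l \<le> m \<and> dot m (row_entry m C (j, l)) i = 1)"
  unfolding digital_net_def dyadic_def
proof (rule sum.cong)
  fix l assume l: "l \<in> {1..m}"
  have "(C j *\<^sub>v digit_vec m i) $ (l - 1) = (\<Sum>p<m. C j $$ (l - 1, p) * digit i p)"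
    using assms l by (auto simp: scalar_prod_def digit_vec_def digit_def atLeast0LessThan intro!: sum.cong)
  also have "\<dots> = dot m (row_entry m C (j, l)) i"
    using assms l unfolding dot_def by (intro sum.cong) (auto simp: row_entry_def gen_row_def)
  finally show "of_bool ((C j *\<^sub>v digit_vec m i) $ (l - 1) = 1) / 2 ^ l =
      (of_bool (l \<le> m \<and> dot m (row_entry m C (j, l)) i = 1) / 2 ^ l :: real)"
    using l by simp
qed simp

lemma dot_row_entry_beyond: "m < l \<Longrightarrow> dot m (row_entry m C (j, l)) i = 0"
  by (simp add: dot_def row_entry_def gen_row_def)

text \<open>The value \<open>c e\<close> is 1 if the two points agree in the digit labelled
  \<open>e\<close> and -1 if not. Hence the product over the first \<open>k\<close> rows, divided by
  \<open>2 ^ k\<close>, is the indicator of agreement there, and \<open>c (j, Suc k)\<close> is the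
  sign.\<close>

lemma gain_factor_net:
  fixes i i' :: nat
  assumes "C j \<in> carrier_mat m m"
  defines "c \<equiv> \<lambda>e. chi (dot m (row_entry m C e) i) * chi (dot m (row_entry m C e) i')"
  shows "gain_factor k (digital_net m C i j) (digital_net m C i' j) =
    1 / 2 ^ k * (\<Prod>l\<in>{1..k}. 1 + c (j, l)) * c (j, Suc k)"
proof -
  let ?d = "\<lambda>l i. dot m (row_entry m C (j, l)) i"
  have c: "c (j, l) = (if ?d l i = ?d l i' then 1 else - 1)" for l
    by (cases "?d l i"; cases "?d l i'") (simp_all add: c_def chi_def)
  have digits: "(l \<le> m \<and> ?d l i = 1) \<noteq> (l \<le> m \<and> ?d l i' = 1) \<longleftrightarrow> ?d l i \<noteq> ?d l i'" for l
    using dot_row_entry_beyond[of m l C j] by (cases "?d l i"; cases "?d l i'"; cases "l \<le> m") (simp_all add: not_le)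
  have "gain_factor k (digital_net m C i j) (digital_net m C i' j) =
      (if \<exists>l\<in>{1..k}. ?d l i \<noteq> ?d l i' then 0 else if ?d (Suc k) i \<noteq> ?d (Suc k) i' then - 1 else 1)"
    unfolding digital_net_eq_dyadic[where C = C, OF assms(1)]
    by (subst gain_factor_dyadic) (simp, simp, simp only: digits)
  moreover have "(\<Prod>l\<in>{1..k}. 1 + c (j, l)) = (if \<exists>l\<in>{1..k}. ?d l i \<noteq> ?d l i' then 0 else 2 ^ k)"
  proof (cases "\<exists>l\<in>{1..k}. ?d l i \<noteq> ?d l i'")
    case True
    then have "(\<Prod>l\<in>{1..k}. 1 + c (j, l)) = 0"
      by (intro prod_zero) (auto simp: c)
    then show ?thesis using True by (simp only: if_True)
  next
    case False
    then have "(\<Prod>l\<in>{1..k}. 1 + c (j, l)) = (\<Prod>l\<in>{1..k}. 2)"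
      by (intro prod.cong) (auto simp: c)
    then show ?thesis using False by (simp only: if_False prod_constant card_atLeastAtMost diff_Suc_1)
  qed
  ultimately show ?thesis
    by (simp only: c) auto
qed

text \<open>Digits after the \<open>m\<close>-th vanish, so agreement in the first \<open>m\<close>
  digits is agreement everywhere.\<close>

lemma gain_factor_min:
  assumes "C j \<in> carrier_mat m m"
  shows "gain_factor (min k m) (digital_net m C i j) (digital_net m C i' j) =
    gain_factor k (digital_net m C i j) (digital_net m C i' j)"
  unfolding digital_net_eq_dyadic[where C = C, OF assms]
  by (subst (1 2) gain_factor_dyadic) (auto simp: min_def)

text \<open>Expanding the product over \<open>row_set u k\<close> gives one character for each
  subset \<open>T\<close>; by orthogonality its double sum vanishes unless \<open>T\<close> and the
  next rows together are dependent.\<close>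

lemma gain_eq_card:
  assumes "finite u" and "\<And>j. j \<in> u \<Longrightarrow> C j \<in> carrier_mat m m"
  shows "gain m C u k = 2 ^ m / 2 ^ (\<Sum>j\<in>u. k j) *
    card {T. T \<subseteq> row_set u k \<and> dependent m (row_entry m C) (T \<union> next_rows u k)}"
proof -
  define x where "x = (\<lambda>e i. chi (dot m (row_entry m C e) i))"
  let ?q = "2 ^ (\<Sum>j\<in>u. k j) :: real"
  have fin: "finite (row_set u k)" "finite (next_rows u k)"
    using assms(1) by (auto simp: row_set_def next_rows_def)
  have disj: "row_set u k \<inter> next_rows u k = {}"
    by (auto simp: row_set_def next_rows_def)
  have factor: "(\<Prod>j\<in>u. gain_factor (k j) (digital_net m C i j) (digital_net m C i' j)) =
      1 / ?q * (\<Sum>T\<in>Pow (row_set u k). \<Prod>e\<in>T \<union> next_rows u k. x e i * x e i')" for i i'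
  proof -
    have "(\<Prod>j\<in>u. gain_factor (k j) (digital_net m C i j) (digital_net m C i' j)) =
        (\<Prod>j\<in>u. 1 / 2 ^ k j * (\<Prod>l\<in>{1..k j}. 1 + x (j, l) i * x (j, l) i') *
          (x (j, Suc (k j)) i * x (j, Suc (k j)) i'))"
      by (intro prod.cong) (auto simp only: gain_factor_net[where C = C, OF assms(2)] x_def)
    also have "\<dots> = 1 / ?q * (\<Prod>e\<in>row_set u k. 1 + x e i * x e i') *
        (\<Prod>e\<in>next_rows u k. x e i * x e i')"
      using assms(1) unfolding row_set_def next_rows_def
      by (simp add: prod.distrib power_sum prod.Sigma prod.reindex inj_on_def prod_dividef case_prod_unfold)
    also have "\<dots> = 1 / ?q * (\<Sum>T\<in>Pow (row_set u k).
        (\<Prod>e\<in>T. x e i * x e i') * (\<Prod>e\<in>next_rows u k. x e i * x e i'))"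
      using fin by (simp add: prod_one_plus sum_distrib_right)
    also have "\<dots> = 1 / ?q * (\<Sum>T\<in>Pow (row_set u k). \<Prod>e\<in>T \<union> next_rows u k. x e i * x e i')"
      using fin disj by (intro arg_cong2[where f = "(*)"] sum.cong refl prod.union_disjoint[symmetric])
        (auto intro: finite_subset)
    finally show ?thesis .
  qed
  \<comment> \<open>The summand is a function of \<open>i\<close> times the same function of
    \<open>i'\<close>, so the double sum is the square of a character sum.\<close>
  have square: "(\<Sum>i<2 ^ m. \<Sum>i'<2 ^ m. \<Prod>e\<in>T \<union> next_rows u k. x e i * x e i') =
      (if dependent m (row_entry m C) (T \<union> next_rows u k) then 2 ^ m * 2 ^ m else 0)"
    if "T \<subseteq> row_set u k" for T
  proof -
    have "finite (T \<union> next_rows u k)"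
      using fin that finite_subset by auto
    then have "(\<Sum>i<2 ^ m. \<Prod>e\<in>T \<union> next_rows u k. x e i) =
        (if dependent m (row_entry m C) (T \<union> next_rows u k) then 2 ^ m else 0)"
      unfolding x_def by (simp only: chi_sum[symmetric] sum_dot sum_chi_dot dependent_def)
    then show ?thesis
      by (simp only: prod.distrib sum_product[symmetric]) simp
  qed
  have "gain m C u k = 1 / 2 ^ m * (1 / ?q * (\<Sum>T\<in>Pow (row_set u k). \<Sum>i<2 ^ m. \<Sum>i'<2 ^ m.
      \<Prod>e\<in>T \<union> next_rows u k. x e i * x e i'))"
    unfolding gain_def factor sum_distrib_left[symmetric]
    by (subst sum.swap[of _ "{..<2 ^ m}" "Pow (row_set u k)"], subst (2) sum.swap) simp
  also have "\<dots> = 1 / 2 ^ m * (1 / ?q * (\<Sum>T\<in>Pow (row_set u k).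
      if dependent m (row_entry m C) (T \<union> next_rows u k) then 2 ^ m * 2 ^ m else 0))"
    using square by (intro arg_cong2[where f = "(*)"] sum.cong refl) auto
  also have "\<dots> = 2 ^ m / ?q * card {T \<in> Pow (row_set u k). dependent m (row_entry m C) (T \<union> next_rows u k)}"
    using fin by (simp add: sum.If_cases Int_def)
  finally show ?thesis by simp
qed

section \<open>Row rank of the stacked matrices\<close>

text \<open>A nonempty dependent set of rows imposes a linear condition on the image, so
  surjectivity fails; conversely, \<open>solvable_if_independent\<close> reaches every right-hand
  side.\<close>

lemma full_row_rank_mat_of_rows:
  assumes "distinct es" and rows: "\<And>e p. e \<in> set es \<Longrightarrow> p < m \<Longrightarrow> f e $ p = r e p"
  shows "full_row_rank (mat_of_rows m (map f es)) \<longleftrightarrow> independent m r (set es)"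
proof -
  define M where "M = mat_of_rows m (map f es)"
  define q where "q = length es"
  have M: "M \<in> carrier_mat q m"
    by (simp add: M_def q_def mat_of_rows_def)
  have mult: "(M *\<^sub>v x) $ i = (\<Sum>p<m. r (es ! i) p * x $ p)"
    if "x \<in> carrier_vec m" "i < q" for x i
    using that M rows
    by (auto simp: scalar_prod_def M_def q_def mat_of_rows_def atLeast0LessThan intro!: sum.cong)
  have "(\<forall>b\<in>carrier_vec q. \<exists>x\<in>carrier_vec m. M *\<^sub>v x = b) \<longleftrightarrow> independent m r (set es)"
  proof
    assume surj: "\<forall>b\<in>carrier_vec q. \<exists>x\<in>carrier_vec m. M *\<^sub>v x = b"
    show "independent m r (set es)"
      unfolding independent_def
    proof (intro allI impI, rule ccontr)
      fix T assume T: "T \<subseteq> set es" "dependent m r T" "T \<noteq> {}"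
      then obtain e0 where e0: "e0 \<in> T" by blast
      then have "e0 \<in> set es" using T(1) by blast
      then obtain i0 where i0: "i0 < q" "es ! i0 \<in> T"
        using e0 by (auto simp: in_set_conv_nth q_def)
      \<comment> \<open>For a preimage of the unit vector at \<open>i0\<close>, the entries
        belonging to \<open>T\<close> sum to 1, whereas dependence of \<open>T\<close> makes them
        sum to 0.\<close>
      obtain x where x: "x \<in> carrier_vec m" "M *\<^sub>v x = unit_vec q i0"
        using surj unit_vec_carrier by blast
      have "(\<Sum>p<m. r e p * x $ p) = of_bool (e = es ! i0)" if "e \<in> T" for e
      proof -
        have "e \<in> set es" using that T(1) by blast
        then obtain i where i: "i < q" "e = es ! i"
          by (auto simp: in_set_conv_nth q_def)
        then show ?thesis
          using mult[OF x(1) i(1)] x(2) i0(1) assms(1) by (auto simp: nth_eq_iff_index_eq q_def)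
      qed
      then have "(\<Sum>e\<in>T. \<Sum>p<m. r e p * x $ p) = (\<Sum>e\<in>T. of_bool (e = es ! i0))"
        by (rule sum.cong[OF refl])
      also have "\<dots> = 1"
        using i0(2) finite_subset[OF T(1)] by (simp add: of_bool_def)
      finally have "(\<Sum>p<m. (\<Sum>e\<in>T. r e p) * x $ p) = 1"
        unfolding sum_distrib_right by (subst sum.swap)
      moreover have "(\<Sum>p<m. (\<Sum>e\<in>T. r e p) * x $ p) = 0"
        using T(2) by (intro sum.neutral) (auto simp: dependent_def)
      ultimately show False
        by simp
    qed
  next
    assume indep: "independent m r (set es)"
    show "\<forall>b\<in>carrier_vec q. \<exists>x\<in>carrier_vec m. M *\<^sub>v x = b"
    proof
      fix b :: "bit vec" assume b: "b \<in> carrier_vec q"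
      \<comment> \<open>The right-hand side, carried over from positions in \<open>es\<close> to
        labels; distinctness makes the position unique.\<close>
      define c where "c e = b $ (inv_into {..<q} ((!) es) e)" for e
      obtain i where i: "\<And>e. e \<in> set es \<Longrightarrow> dot m (r e) i = c e"
        using solvable_if_independent[OF finite_set indep] by blast
      have "inj_on ((!) es) {..<q}"
        using assms(1) by (auto intro!: inj_on_nth simp: q_def)
      then have "c (es ! n) = b $ n" if "n < q" for n
        using that unfolding c_def by (subst inv_into_f_f) auto
      moreover have "(M *\<^sub>v digit_vec m i) $ n = dot m (r (es ! n)) i" if "n < q" for n
        using mult[of "digit_vec m i" n] that by (simp add: digit_vec_def digit_def dot_def)
      ultimately have "M *\<^sub>v digit_vec m i = b"
        using b M i nth_mem by (intro eq_vecI) (simp_all add: q_def)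
      then show "\<exists>x\<in>carrier_vec m. M *\<^sub>v x = b"
        by (intro bexI[of _ "digit_vec m i"]) (auto simp: digit_vec_def)
    qed
  qed
  then show ?thesis
    using rank_eq_dim_row_iff[OF M] M unfolding full_row_rank_def M_def by auto
qed

lemma distinct_concat_map_Pair:
  "distinct xs \<Longrightarrow> (\<And>x. distinct (f x)) \<Longrightarrow> distinct (concat (map (\<lambda>x. map (Pair x) (f x)) xs))"
  by (induction xs) (auto simp: distinct_map inj_on_def)

lemma full_row_rank_stacked_iff:
  assumes "finite u"
  shows "full_row_rank (stacked m C u k) \<longleftrightarrow> independent m (row_entry m C) (row_set u k)"
proof -
  \<comment> \<open>The labels in the order in which \<open>stacked\<close> lists its rows.\<close>
  define es where "es = concat (map (\<lambda>j. map (Pair j) [1..<Suc (k j)]) (sorted_list_of_set u))"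
  have "stacked m C u k = mat_of_rows m (map (\<lambda>e. gen_row m (C (fst e)) (snd e)) es)"
    by (simp add: stacked_def es_def map_concat comp_def)
  moreover have "set es = row_set u k"
    using assms by (simp only: es_def row_set_def set_concat set_map image_image set_upt
      set_sorted_list_of_set) (force simp: Sigma_def)
  moreover have "distinct es"
    unfolding es_def by (intro distinct_concat_map_Pair) simp_all
  ultimately show ?thesis
    using full_row_rank_mat_of_rows[of es m "\<lambda>e. gen_row m (C (fst e)) (snd e)" "row_entry m C"]
    by (simp add: row_entry_def)
qed

lemma dim_row_stacked: "finite u \<Longrightarrow> dim_row (stacked m C u k) = (\<Sum>j\<in>u. k j)"
  by (simp add: stacked_def length_concat comp_def sum_list_distinct_conv_sum_set del: upt_Suc)

section \<open>Bounds for gain coefficients and their maximum\<close>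

text \<open>In the symmetric difference of two counted relations the next rows cancel. If the sets
  agree outside \<open>J\<close>, what remains is a dependent subset of \<open>J\<close>, hence
  empty; so there are at most as many sets as subsets of the rows outside \<open>J\<close>.\<close>

lemma gain_le:
  assumes "finite u" and "\<And>j. j \<in> u \<Longrightarrow> C j \<in> carrier_mat m m"
    and "J \<subseteq> row_set u k" and "independent m (row_entry m C) J"
  shows "gain m C u k \<le> 2 ^ m / 2 ^ card J"
proof -
  let ?I = "row_set u k" and ?N = "next_rows u k"
  let ?F = "{T. T \<subseteq> ?I \<and> dependent m (row_entry m C) (T \<union> ?N)}"
  have fin: "finite ?I" "finite ?N"
    using assms(1) by (auto simp: row_set_def next_rows_def)
  have disj: "?I \<inter> ?N = {}"
    by (auto simp: row_set_def next_rows_def)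
  have "inj_on (\<lambda>T. T - J) ?F"
  proof (rule inj_onI)
    fix S T assume ST: "S \<in> ?F" "T \<in> ?F" "S - J = T - J"
    then have "dependent m (row_entry m C) (S \<union> ?N - (T \<union> ?N) \<union> (T \<union> ?N - (S \<union> ?N)))"
      using fin finite_subset by (intro dependent_sym_diff) auto
    moreover have "S \<union> ?N - (T \<union> ?N) \<union> (T \<union> ?N - (S \<union> ?N)) = S - T \<union> (T - S)"
      using ST disj by blast
    moreover have "S - T \<union> (T - S) \<subseteq> J"
      using ST(3) by blast
    ultimately have "S - T \<union> (T - S) = {}"
      using assms(4) by (simp only: independent_def)
    then show "S = T" by blast
  qed
  then have "card ?F \<le> card (Pow (?I - J))"
    using fin by (intro card_inj_on_le) auto
  also have "\<dots> = 2 ^ (card ?I - card J)"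
    using fin assms(3) by (simp add: card_Pow card_Diff_subset finite_subset)
  finally have "real (card ?F) \<le> real (2 ^ (card ?I - card J))"
    by (simp only: of_nat_le_iff)
  also have "\<dots> = 2 ^ (card ?I - card J)"
    by simp
  also have "\<dots> = 2 ^ card ?I / 2 ^ card J"
    using card_mono[OF fin(1) assms(3)] by (simp add: power_diff)
  finally have "2 ^ m / 2 ^ card ?I * real (card ?F) \<le> 2 ^ m / 2 ^ card ?I * (2 ^ card ?I / 2 ^ card J)"
    by (intro mult_left_mono) auto
  moreover have "card ?I = (\<Sum>j\<in>u. k j)"
    using assms(1) by (simp add: row_set_def)
  ultimately show ?thesis
    using gain_eq_card[of u C m k] assms(1,2) by simp
qed

lemma gain_ge:
  assumes "finite u" and "\<And>j. j \<in> u \<Longrightarrow> C j \<in> carrier_mat m m"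
    and "T \<subseteq> row_set u k" and "dependent m (row_entry m C) (T \<union> next_rows u k)"
  shows "2 ^ m / 2 ^ (\<Sum>j\<in>u. k j) \<le> gain m C u k"
proof -
  let ?F = "{T. T \<subseteq> row_set u k \<and> dependent m (row_entry m C) (T \<union> next_rows u k)}"
  have "finite (row_set u k)"
    using assms(1) by (simp add: row_set_def)
  then have "finite ?F"
    by (rule_tac finite_subset[of _ "Pow (row_set u k)"]) auto
  then have "1 \<le> card ?F"
    using assms(3,4) by (auto simp: Suc_le_eq card_gt_0_iff)
  then have "2 ^ m / 2 ^ (\<Sum>j\<in>u. k j) * 1 \<le> 2 ^ m / 2 ^ (\<Sum>j\<in>u. k j) * real (card ?F)"
    by (intro mult_left_mono) auto
  then show ?thesis
    using gain_eq_card[of u C m k] assms(1,2) by simp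
qed

text \<open>Truncating the tuple at \<open>m\<close> preserves every gain factor. This finiteness
  makes the inner \<open>Max\<close> of \<open>max_gain\<close> a true maximum.\<close>

lemma finite_range_gain:
  assumes "finite u" and "\<And>j. j \<in> u \<Longrightarrow> C j \<in> carrier_mat m m"
  shows "finite (range (gain m C u))"
proof (rule finite_subset)
  show "range (gain m C u) \<subseteq> gain m C u ` (u \<rightarrow>\<^sub>E {0..m})"
  proof (rule image_subsetI)
    fix k
    have "gain m C u k = gain m C u (\<lambda>j\<in>u. min (k j) m)"
      unfolding gain_def
      by (intro arg_cong2[where f = "(*)"] sum.cong prod.cong refl)
        (simp add: gain_factor_min[where C = C, OF assms(2)])
    then show "gain m C u k \<in> gain m C u ` (u \<rightarrow>\<^sub>E {0..m})"
      by (rule image_eqI[of _ "gain m C u"]) auto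
  qed
  show "finite (gain m C u ` (u \<rightarrow>\<^sub>E {0..m}))"
    using assms(1) by (intro finite_imageI finite_PiE) auto
qed

lemma max_gain_eqI:
  assumes "\<And>j. j \<in> {1..s} \<Longrightarrow> C j \<in> carrier_mat m m"
    and le: "\<And>u k. u \<noteq> {} \<Longrightarrow> u \<subseteq> {1..s} \<Longrightarrow> gain m C u k \<le> V"
    and "v \<noteq> {}" "v \<subseteq> {1..s}" "V \<le> gain m C v k"
  shows "max_gain m s C = V"
proof -
  have fin: "finite (range (gain m C u))" if "u \<subseteq> {1..s}" for u
    using that assms(1) finite_subset by (intro finite_range_gain) auto
  have "Max (range (gain m C v)) = V"
    using fin assms(3-5) le[of v] by (intro Max_eqI) (auto simp: image_iff, metis order_antisym)
  moreover have "Max (range (gain m C u)) \<le> V" if "u \<noteq> {}" "u \<subseteq> {1..s}" for u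
    using fin[OF that(2)] le[OF that] by (simp add: Max_le_iff image_subset_iff)
  ultimately show ?thesis
    unfolding max_gain_def using assms(3,4) by (intro Max_eqI) auto
qed

section \<open>Least deficient weight and the maximal gain\<close>

text \<open>Starting from the zero tuple, some entry can be raised by one as long as the weight is
  below that of \<open>k\<close>.\<close>

lemma obtain_smaller_tuple:
  fixes k :: "'a \<Rightarrow> nat"
  assumes "finite u" and "q \<le> (\<Sum>j\<in>u. k j)"
  obtains k' where "\<And>j. j \<in> u \<Longrightarrow> k' j \<le> k j" and "(\<Sum>j\<in>u. k' j) = q"
proof -
  have "\<exists>k'. (\<forall>j\<in>u. k' j \<le> k j) \<and> (\<Sum>j\<in>u. k' j) = q"
    using assms(2)
  proof (induction q)
    case 0
    then show ?case by (intro exI[of _ "\<lambda>_. 0"]) auto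
  next
    case (Suc q)
    then obtain k' where k': "\<forall>j\<in>u. k' j \<le> k j" "(\<Sum>j\<in>u. k' j) = q" by auto
    have "\<exists>j\<in>u. k' j < k j"
      using sum_mono[of u k k'] k'(2) Suc.prems by force
    then obtain j where j: "j \<in> u" "k' j < k j" by blast
    have "(\<Sum>i\<in>u. (k'(j := Suc (k' j))) i) = Suc q"
      using k'(2) j(1) assms(1) by (simp add: sum.remove[of u j])
    then show ?case
      using k'(1) j(2) by (intro exI[of _ "k'(j := Suc (k' j))"]) auto
  qed
  then show ?thesis using that by blast
qed

text \<open>The summand \<open>s\<close> is the shift between weights of positive tuples on all
  coordinates and weights of tuples on \<open>u\<close>.\<close>

lemma sum_extend_plus_one:
  fixes h :: "nat \<Rightarrow> nat"
  assumes "u \<subseteq> {1..s}"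
  shows "(\<Sum>j=1..s. (if j \<in> u then h j else 0) + 1) = (\<Sum>j\<in>u. h j) + s"
proof -
  have "(\<Sum>j=1..s. if j \<in> u then h j else 0) = (\<Sum>j\<in>u. h j)"
    using sum.inter_restrict[of "{1..s}" h u] assms by (simp add: Int_absorb1)
  then show ?thesis
    unfolding sum.distrib by simp
qed

text \<open>Here \<open>P\<close> is the condition minimised in \<open>t_star\<close>, with full row
  rank expressed by \<open>independent\<close>.\<close>

lemma max_gain_eq_least_weight:
  fixes m s :: nat and C :: "nat \<Rightarrow> bit mat"
  assumes "s \<ge> 1" and carrier: "\<And>j. j \<in> {1..s} \<Longrightarrow> C j \<in> carrier_mat m m"
  defines "P \<equiv> \<lambda>w. \<exists>k. w = (\<Sum>j=1..s. k j) \<and> (\<forall>j\<in>{1..s}. 1 \<le> k j) \<and>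
    \<not> independent m (row_entry m C) (row_set {1..s} k)"
  shows "s \<le> Least P" and "max_gain m s C = 2 ^ m / 2 ^ (Least P - s)"
proof -
  let ?S = "{1..s}"
  let ?r = "row_entry m C"
  define w where "w = Least P"
  \<comment> \<open>Row \<open>Suc m\<close> is zero by convention and so dependent on its own;
    hence some weight satisfies \<open>P\<close>.\<close>
  have "\<not> independent m ?r (row_set ?S (\<lambda>_. Suc m))"
    unfolding independent_def not_all not_imp
  proof (intro exI conjI)
    show "{(1, Suc m)} \<subseteq> row_set ?S (\<lambda>_. Suc m)"
      using assms(1) by (auto simp: row_set_def)
    show "dependent m ?r {(1, Suc m)}"
      by (simp add: dependent_def row_entry_def gen_row_def)
  qed simp
  then have "P (\<Sum>j\<in>?S. Suc m)"
    unfolding P_def by fastforce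
  then have "P w"
    unfolding w_def by (rule LeastI)
  then obtain k where k: "w = (\<Sum>j\<in>?S. k j)" "\<And>j. j \<in> ?S \<Longrightarrow> 1 \<le> k j"
    and dep: "\<not> independent m ?r (row_set ?S k)"
    unfolding P_def by blast
  have minimal: "independent m ?r (row_set ?S k')"
    if "(\<Sum>j\<in>?S. k' j) < w" "\<And>j. j \<in> ?S \<Longrightarrow> 1 \<le> k' j" for k'
    using not_less_Least[of "\<Sum>j\<in>?S. k' j" P] that unfolding w_def P_def by blast
  have "(\<Sum>j\<in>?S. 1) \<le> (\<Sum>j\<in>?S. k j)"
    using k(2) by (rule sum_mono)
  then have sw: "s \<le> w"
    using k(1) by simp
  then show "s \<le> Least P"
    by (simp add: w_def)

  from dep obtain T where T: "T \<subseteq> row_set ?S k" "dependent m ?r T" "T \<noteq> {}"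
    by (auto simp: independent_def)
  \<comment> \<open>The blocks whose last row occurs in the relation. Shortening them by one row, in
    \<open>k'\<close>, turns these last rows into next rows.\<close>
  define v where "v = {j \<in> ?S. (j, k j) \<in> T}"
  define k' where "k' j = k j - 1" for j
  \<comment> \<open>By minimality of the tuple, the relation involves the last row of every block with more than
    one row.\<close>
  have k1: "k j = 1" if "j \<in> ?S" "j \<notin> v" for j
  proof (rule ccontr)
    assume "k j \<noteq> 1"
    then have "2 \<le> k j"
      using k(2)[OF that(1)] by simp
    have "(\<Sum>i\<in>?S. (k(j := k j - 1)) i) < w"
      unfolding k(1) using that(1) \<open>2 \<le> k j\<close> by (intro sum_strict_mono_ex1) auto
    then have "independent m ?r (row_set ?S (k(j := k j - 1)))"
      using k(2) \<open>2 \<le> k j\<close> by (intro minimal) auto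
    moreover have "T \<subseteq> row_set ?S (k(j := k j - 1))"
    proof
      fix e assume "e \<in> T"
      then obtain a l where e: "e = (a, l)" "a \<in> ?S" "1 \<le> l" "l \<le> k a"
        using T(1) by (auto simp: row_set_def)
      moreover have "l \<noteq> k j" if "a = j"
        using that \<open>e \<in> T\<close> e(1) \<open>j \<in> ?S\<close> \<open>j \<notin> v\<close> by (auto simp: v_def)
      ultimately show "e \<in> row_set ?S (k(j := k j - 1))"
        by (auto simp: row_set_def)
    qed
    ultimately show False
      using T(2,3) by (auto simp: independent_def)
  qed
  have v: "v \<subseteq> ?S" "finite v"
    by (auto simp: v_def)
  have split: "T = (T - next_rows v k') \<union> next_rows v k'"
    using k(2) by (force simp: next_rows_def v_def k'_def)
  have rest: "T - next_rows v k' \<subseteq> row_set v k'"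
  proof
    fix e assume e: "e \<in> T - next_rows v k'"
    then obtain a l where al: "e = (a, l)" "a \<in> ?S" "1 \<le> l" "l \<le> k a"
      using T(1) by (auto simp: row_set_def)
    have "a \<in> v"
    proof (rule ccontr)
      assume "a \<notin> v"
      \<comment> \<open>A block outside \<open>v\<close> has just one row, which is also its last,
        so its occurrence in \<open>T\<close> would put \<open>a\<close> into
        \<open>v\<close>.\<close>
      then have "l = k a"
        using k1[OF al(2)] al(3,4) by simp
      then show False
        using \<open>a \<notin> v\<close> al(1,2) e by (simp add: v_def)
    qed
    moreover from this have "l \<noteq> k a"
      using e al(1) k(2)[OF al(2)] by (auto simp: next_rows_def k'_def)
    ultimately show "e \<in> row_set v k'"
      using al by (auto simp: row_set_def k'_def)
  qed
  have "v \<noteq> {}"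
    using split rest T(3) by (auto simp: row_set_def next_rows_def)
  \<comment> \<open>Outside \<open>v\<close> the blocks have a single row, so \<open>k'\<close> is 0
    there.\<close>
  have "(\<Sum>j\<in>v. k' j) = (\<Sum>j\<in>?S. k' j)"
    using v k1 by (intro sum.mono_neutral_left) (auto simp: k'_def)
  also have "\<dots> = w - s"
    unfolding k(1) k'_def using k(2) by (subst sum_subtractf_nat) simp_all
  finally have sum_k': "(\<Sum>j\<in>v. k' j) = w - s" .
  have carrier_v: "C j \<in> carrier_mat m m" if "j \<in> v" for j
    using that v(1) carrier by blast
  have lower: "2 ^ m / 2 ^ (w - s) \<le> gain m C v k'"
    using gain_ge[where C = C, OF v(2) carrier_v rest] T(2) split sum_k' by simp

  have upper: "gain m C u h \<le> 2 ^ m / 2 ^ (w - s)" if u: "u \<noteq> {}" "u \<subseteq> ?S" for u h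
  proof -
    have fin: "finite u"
      using u(2) finite_subset by blast
    have carrier_u: "C j \<in> carrier_mat m m" if "j \<in> u" for j
      using that u(2) carrier by blast
    show ?thesis
    proof (cases "\<exists>T. T \<subseteq> row_set u h \<and> dependent m ?r (T \<union> next_rows u h)")
      case False
      then have none: "{T. T \<subseteq> row_set u h \<and> dependent m ?r (T \<union> next_rows u h)} = {}"
        by blast
      have "gain m C u h = 0"
        using gain_eq_card[where C = C and k = h, OF fin carrier_u] unfolding none by simp
      then show ?thesis by simp
    next
      case True
      then obtain R where R: "R \<subseteq> row_set u h" "dependent m ?r (R \<union> next_rows u h)"
        by blast
      \<comment> \<open>One more row in each block of \<open>u\<close> takes in the next rows; the
        value 1 elsewhere makes the tuple positive, as \<open>P\<close> requires.\<close>
      define g where "g j = (if j \<in> u then h j + 1 else 1)" for j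
      have "R \<union> next_rows u h \<subseteq> row_set ?S g"
        using R(1) u(2) by (force simp: row_set_def next_rows_def g_def)
      moreover have "R \<union> next_rows u h \<noteq> {}"
        using u(1) by (auto simp: next_rows_def)
      ultimately have "\<not> independent m ?r (row_set ?S g)"
        using R(2) unfolding independent_def by blast
      moreover have "independent m ?r (row_set ?S g)" if "(\<Sum>j\<in>?S. g j) < w"
        using that by (rule minimal) (simp add: g_def)
      ultimately have "w \<le> (\<Sum>j\<in>?S. g j)"
        using not_le by blast
      also have "\<dots> = (\<Sum>j\<in>?S. (if j \<in> u then h j else 0) + 1)"
        by (intro sum.cong) (auto simp: g_def)
      also have "\<dots> = (\<Sum>j\<in>u. h j) + s"
        using u(2) by (rule sum_extend_plus_one)
      finally have le: "w - s \<le> (\<Sum>j\<in>u. h j)"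
        by simp
      \<comment> \<open>Weight exactly \<open>w - s\<close> yields the exponent of the bound, with
        rows still taken from those of \<open>h\<close>.\<close>
      obtain q where q: "\<And>j. j \<in> u \<Longrightarrow> q j \<le> h j" "(\<Sum>j\<in>u. q j) = w - s"
        using obtain_smaller_tuple[OF fin le] by blast
      have "independent m ?r (row_set u q)"
      proof (cases "\<exists>j\<in>u. q j \<noteq> 0")
        case False
        then have "row_set u q = {}"
          by (auto simp: row_set_def)
        then show ?thesis
          by (simp add: independent_def)
      next
        case True
        then obtain j0 where j0: "j0 \<in> u" "q j0 \<noteq> 0" by blast
        define q' where "q' j = (if j \<in> u then q j else 0)" for j
        \<comment> \<open>Since \<open>max 1 a \<le> a + 1\<close>, strictly at \<open>j0\<close>,
          this positive tuple has weight below \<open>w - s + s = w\<close>, and minimality applies.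
          The zero tuple, where strictness would fail, has no rows.\<close>
        have "(\<Sum>j\<in>?S. max 1 (q' j)) < (\<Sum>j\<in>?S. q' j + 1)"
          using j0 u(2) by (intro sum_strict_mono_ex1) (auto simp: q'_def intro!: bexI[of _ j0])
        also have "\<dots> = (\<Sum>j\<in>u. q j) + s"
          unfolding q'_def using u(2) by (rule sum_extend_plus_one)
        finally have "independent m ?r (row_set ?S (\<lambda>j. max 1 (q' j)))"
          using q(2) sw by (intro minimal) auto
        moreover have "row_set u q \<subseteq> row_set ?S (\<lambda>j. max 1 (q' j))"
          using u(2) by (auto simp: row_set_def q'_def)
        ultimately show ?thesis
          by (rule independent_subset)
      qed
      moreover have "row_set u q \<subseteq> row_set u h"
        using q(1) by (force simp: row_set_def)
      moreover have "card (row_set u q) = w - s"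
        using fin q(2) by (simp add: row_set_def)
      ultimately show ?thesis
        using gain_le[where C = C and J = "row_set u q" and k = h, OF fin carrier_u] by simp
    qed
  qed
  show "max_gain m s C = 2 ^ m / 2 ^ (Least P - s)"
    using max_gain_eqI[OF carrier upper \<open>v \<noteq> {}\<close> v(1) lower] by (simp add: w_def)
qed

section \<open>The two cases of the maximal gain\<close>

theorem corollary5:
  fixes m s :: nat and C :: "nat \<Rightarrow> bit mat"
  assumes "m \<ge> 1" and "s \<ge> 1"
    and "\<And>j. j \<in> {1..s} \<Longrightarrow> C j \<in> carrier_mat m m"
  shows "((\<exists>u. u \<noteq> {} \<and> u \<subseteq> {1..s} \<and> mat_rank (stacked m C u (\<lambda>_. 1)) < card u)
            \<longrightarrow> max_gain m s C = 2 ^ m) \<and>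
         (\<not> (\<exists>u. u \<noteq> {} \<and> u \<subseteq> {1..s} \<and> mat_rank (stacked m C u (\<lambda>_. 1)) < card u)
            \<longrightarrow> max_gain m s C = 2 powi (t_star m C {1..s} + int s - 1))"
proof -
  define P where "P = (\<lambda>w. \<exists>k. w = (\<Sum>j=1..s. k j) \<and> (\<forall>j\<in>{1..s}. 1 \<le> k j) \<and>
    \<not> independent m (row_entry m C) (row_set {1..s} k))"
  have sw: "s \<le> Least P" and gain: "max_gain m s C = 2 ^ m / 2 ^ (Least P - s)"
    using max_gain_eq_least_weight[OF assms(2,3)] unfolding P_def by simp_all
  have "t_star m C {1..s} = int m + 1 - int (Least P)"
    unfolding t_star_def P_def full_row_rank_stacked_iff[OF finite_atLeastAtMost] by (rule refl)
  \<comment> \<open>The bound \<open>s \<le> Least P\<close> makes the natural subtraction agree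
    with the integer one.\<close>
  then have "t_star m C {1..s} + int s - 1 = int m - int (Least P - s)"
    using sw by simp
  then have "max_gain m s C = 2 powi (t_star m C {1..s} + int s - 1)"
    using gain by (simp add: power_int_diff)
  moreover have "max_gain m s C = 2 ^ m"
    if "u \<subseteq> {1..s}" "mat_rank (stacked m C u (\<lambda>_. 1)) < card u" for u
  proof -
    have "finite u"
      using that(1) finite_subset by blast
    then have "\<not> independent m (row_entry m C) (row_set u (\<lambda>_. 1))"
      using that(2) full_row_rank_stacked_iff[of u m C "\<lambda>_. 1"] dim_row_stacked[of u m C "\<lambda>_. 1"]
      by (simp add: full_row_rank_def)
    \<comment> \<open>Adding the first rows of the other coordinates preserves dependence, so the
      all-ones tuple on \<open>{1..s}\<close> attains the smallest possible weight
      \<open>s\<close>.\<close>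
    moreover have "row_set u (\<lambda>_. 1) \<subseteq> row_set {1..s} (\<lambda>_. 1)"
      using that(1) by (auto simp: row_set_def)
    ultimately have "\<not> independent m (row_entry m C) (row_set {1..s} (\<lambda>_. 1))"
      using independent_subset by blast
    then have "P s"
      unfolding P_def by (intro exI[of _ "\<lambda>_. 1"]) simp
    then have "Least P = s"
      using sw by (simp add: Least_le order_antisym)
    then show ?thesis
      using gain by simp
  qed
  ultimately show ?thesis by blast
qed

end
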